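(* Let $\Delta\geq3$ be an integer and let $\ell_1,\ell_2,\dotsc,\ell_\Delta$ be positive integers. Then the spider $S_{\ell_1,\ell_2,\dotsc,\ell_\Delta}$ satisfies $s(S_{\ell_1,\ell_2,\dotsc,\ell_\Delta})=\Delta$.
   Context: A vertex labeling of a graph $G$ is an injective map $f:V(G)\to\mathbb{Z}$. It induces the edge labeling $f^+:E(G)\to\mathbb{Z}$, $f^+(uv)=f(u)+f(v)$, and $|f^+|$ denotes the number of distinct values $f^+$ takes on $E(G)$. The sum index $s(G)$ is the minimum positive integer $k$ such that there exists a vertex labeling $f$ of $G$ with $|f^+|=k$. The spider $S_{\ell_1,\ell_2,\dotsc,\ell_\Delta}$ is the graph consisting of a center vertex $v_0$ which serves as a common endpoint of $\Delta$ paths $v_0v_{i,1}v_{i,2}\dotsb v_{i,\ell_i}$, $1\leq i\leq\Delta$, where all the vertices $v_0$ and $v_{i,j}$ are distinct. *)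

theory Defs
  imports "Graph_Theory.Pair_Digraph"
begin

text \<open>
  An undirected simple graph is a \<^locale>\<open>pair_graph\<close>: an edge \<open>uv\<close> is the pair of arcs
  \<open>(u, v)\<close>, \<open>(v, u)\<close>. The two arcs carry the same label \<open>f u + f v\<close>, so the set of values
  of the induced labeling on arcs is the set of its values on edges.
\<close>

definition vertex_labeling :: "'v pair_pre_digraph \<Rightarrow> ('v \<Rightarrow> int) \<Rightarrow> bool" where
  "vertex_labeling G f \<longleftrightarrow> inj_on f (pverts G)"

definition edge_labeling :: "('v \<Rightarrow> int) \<Rightarrow> 'v \<times> 'v \<Rightarrow> int" where
  "edge_labeling f = (\<lambda>(u, v). f u + f v)"

definition num_edge_labels :: "'v pair_pre_digraph \<Rightarrow> ('v \<Rightarrow> int) \<Rightarrow> nat" where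
  "num_edge_labels G f = card (edge_labeling f ` parcs G)"

definition sum_index :: "'v pair_pre_digraph \<Rightarrow> nat" where
  "sum_index G = (LEAST k. k > 0 \<and> (\<exists>f. vertex_labeling G f \<and> num_edge_labels G f = k))"

text \<open>The minimum in \<^const>\<open>sum_index\<close> exists for every finite graph with at least one edge.\<close>

lemma sum_index_attained:
  assumes "pair_graph G" and "parcs G \<noteq> {}"
  shows "sum_index G > 0 \<and> (\<exists>f. vertex_labeling G f \<and> num_edge_labels G f = sum_index G)"
proof -
  interpret pair_graph G by fact
  obtain g :: "'a \<Rightarrow> nat" where g: "inj_on g (pverts G)"
    using finite_imp_inj_to_nat_seg[OF finite_verts] by auto
  define f where "f v = int (g v)" for v
  have "vertex_labeling G f"
    using g by (auto simp: vertex_labeling_def f_def inj_on_def)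
  moreover have "num_edge_labels G f > 0"
    using assms(2) finite_arcs by (simp add: num_edge_labels_def card_gt_0_iff)
  ultimately have "\<exists>k. k > 0 \<and> (\<exists>f. vertex_labeling G f \<and> num_edge_labels G f = k)"
    by blast
  then show ?thesis
    unfolding sum_index_def by (rule LeastI_ex)
qed

datatype spider_vertex = Center | Leg nat nat

text \<open>The \<open>j\<close>-th vertex on the path from the center along leg \<open>i\<close>; position \<open>0\<close> is the center.\<close>

definition leg_vertex :: "nat \<Rightarrow> nat \<Rightarrow> spider_vertex" where
  "leg_vertex i j = (if j = 0 then Center else Leg i j)"

text \<open>The spider with legs \<open>1, \<dots>, d\<close>, where leg \<open>i\<close> has length \<open>l i\<close>.\<close>

definition spider_edges :: "nat \<Rightarrow> (nat \<Rightarrow> nat) \<Rightarrow> (spider_vertex \<times> spider_vertex) set" where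
  "spider_edges d l = {(leg_vertex i j, leg_vertex i (Suc j)) | i j. i \<in> {1..d} \<and> j < l i}"

definition spider :: "nat \<Rightarrow> (nat \<Rightarrow> nat) \<Rightarrow> spider_vertex pair_pre_digraph" where
  "spider d l =
    \<lparr> pverts = insert Center {Leg i j | i j. i \<in> {1..d} \<and> j \<in> {1..l i}},
      parcs = spider_edges d l \<union> (spider_edges d l)\<inverse> \<rparr>"

lemma pair_graph_spider: "pair_graph (spider d l)"
proof -
  have "{Leg i j | i j. i \<in> {1..d} \<and> j \<in> {1..l i}}
      = (\<lambda>(i, j). Leg i j) ` (SIGMA i:{1..d}. {1..l i})"
    by auto
  then have fin: "finite (pverts (spider d l))"
    by (simp add: spider_def)
  have sub: "parcs (spider d l) \<subseteq> pverts (spider d l) \<times> pverts (spider d l)"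
    by (auto simp: spider_def spider_edges_def leg_vertex_def)
  have fina: "finite (parcs (spider d l))"
    using finite_subset[OF sub] fin by blast
  have sym: "sym (parcs (spider d l))"
    by (auto simp: spider_def sym_def)
  have loop: "fst e \<noteq> snd e" if "e \<in> parcs (spider d l)" for e
    using that by (auto simp: spider_def spider_edges_def leg_vertex_def split: if_splits)
  have symm: "symmetric (with_proj (spider d l))"
    using sym by (simp add: symmetric_def arcs_ends_conv)
  show ?thesis
    using fin fina sub loop symm by unfold_locales auto
qed

end

theory Submission
  imports Defs
begin

text \<open>
  The center is adjacent to \<open>\<Delta>\<close> vertices with distinct labels, so the edges at the center already
  carry \<open>\<Delta>\<close> distinct sums; this gives the lower bound (\<open>card_neighbours_le_num_edge_labels\<close>).

  For the upper bound, a path on which two sums \<open>a, b\<close> alternate, starting with label \<open>c\<close>, has labels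
  \<open>c\<close>, \<open>a - c\<close>, \<open>c + (b - a)\<close>, \<open>a - c - (b - a)\<close>, and so on: two arithmetic progressions.
  With \<open>s\<^sub>1 = 0\<close> and \<open>\<Delta> - 1\<close> further sums \<open>s\<^sub>2, \<dots>, s\<^sub>\<Delta>\<close>, leg \<open>i \<ge> 2\<close> alternates
  \<open>s\<^sub>i, 0, s\<^sub>i, \<dots>\<close> and leg \<open>1\<close> alternates \<open>0, s\<^sub>2, 0, \<dots>\<close>. With center label \<open>1\<close> every label has the form
  \<open>\<plusminus>(1 - t)\<close>, where the sign is the parity of the distance \<open>j\<close> from the center and
  \<open>t = \<lceil>j/2\<rceil> s\<^sub>i\<close> on leg \<open>i \<ge> 2\<close>, while \<open>t = - \<lfloor>j/2\<rfloor> s\<^sub>2\<close> on leg \<open>1\<close>.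
  It remains to choose the \<open>s\<^sub>i\<close> so that no two labels coincide, and \<open>s\<^sub>i = 3 B\<^sup>i\<close> with \<open>B\<close> larger than
  all leg lengths works: divisibility by \<open>3\<close> makes the labels at even distance congruent to \<open>1\<close> and those
  at odd distance congruent to \<open>-1\<close> modulo \<open>3\<close>; the sign of \<open>t\<close> separates leg \<open>1\<close> from the others;
  and \<open>k B\<^sup>i\<close> with \<open>0 < k < B\<close> determines both \<open>k\<close> and \<open>i\<close>, as a numeral in base \<open>B\<close> with a
  single nonzero digit.
\<close>

lemma card_neighbours_le_num_edge_labels:
  assumes "pair_graph G" and "vertex_labeling G f"
  shows "card {v. (u, v) \<in> parcs G} \<le> num_edge_labels G f"
proof -
  interpret pair_graph G by fact
  let ?N = "{v. (u, v) \<in> parcs G}"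
  have "?N \<subseteq> pverts G"
    using in_arcsD2 by auto
  then have "inj_on (\<lambda>v. edge_labeling f (u, v)) ?N"
    using assms(2) by (auto simp: vertex_labeling_def edge_labeling_def inj_on_def)
  then have "card ?N = card ((\<lambda>v. edge_labeling f (u, v)) ` ?N)"
    by (simp add: card_image)
  also have "\<dots> \<le> card (edge_labeling f ` parcs G)"
    using finite_arcs by (intro card_mono) auto
  finally show ?thesis
    by (simp add: num_edge_labels_def)
qed

text \<open>Numerals of different lengths in base \<open>B\<close> differ in size, so \<open>i\<close> is determined first.\<close>

lemma single_digit_numeral_unique:
  fixes B :: nat
  assumes "k * B ^ i = k' * B ^ i'" and "0 < k" "k < B" "0 < k'" "k' < B"
  shows "k = k' \<and> i = i'"
proof -
  have less: "a * B ^ m < b * B ^ n" if "m < n" "a < B" "0 < b" for a b m n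
  proof -
    have "a * B ^ m < B ^ Suc m"
      using that by simp
    also have "\<dots> \<le> B ^ n"
      using that by (intro power_increasing) auto
    also have "\<dots> \<le> b * B ^ n"
      using that by simp
    finally show ?thesis .
  qed
  have "i = i'"
    using less[of i i' k k'] less[of i' i k' k] assms by (metis less_irrefl nat_neq_iff)
  with assms show ?thesis
    by auto
qed

text \<open>The quantity \<open>t\<close> for which the vertex at distance \<open>j\<close> on leg \<open>i\<close> has label \<open>\<plusminus>(1 - t)\<close>.\<close>

definition leg_shift :: "nat \<Rightarrow> nat \<Rightarrow> nat \<Rightarrow> int" where
  "leg_shift B i j =
    (if i = 1 then - int (3 * (j div 2 * B ^ 2)) else int (3 * (Suc j div 2 * B ^ i)))"

fun spider_labeling :: "nat \<Rightarrow> spider_vertex \<Rightarrow> int" where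
  "spider_labeling B Center = 1"
| "spider_labeling B (Leg i j) = (if even j then 1 - leg_shift B i j else leg_shift B i j - 1)"

text \<open>All shifts vanish at distance \<open>0\<close>, so the formula for the legs covers the center as well.\<close>

lemma spider_labeling_leg_vertex:
  "spider_labeling B (leg_vertex i j) =
    (if even j then 1 - leg_shift B i j else leg_shift B i j - 1)"
  by (auto simp: leg_vertex_def leg_shift_def)

text \<open>
  Consecutive labels \<open>\<plusminus>(1 - t)\<close> and \<open>\<mp>(1 - t')\<close> add up to \<open>\<plusminus>(t' - t)\<close>, and \<open>t\<close> changes on every
  second step only.
\<close>

lemma spider_labeling_consecutive_sum:
  "spider_labeling B (leg_vertex i j) + spider_labeling B (leg_vertex i (Suc j)) =
    (if even j \<longleftrightarrow> i = 1 then 0 else int (3 * B ^ (if i = 1 then 2 else i)))"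
  unfolding spider_labeling_leg_vertex leg_shift_def
  by (cases "even j") (auto elim!: evenE oddE simp: algebra_simps)

lemma spider_labeling_eq_imp_eq:
  assumes eq: "spider_labeling B (leg_vertex i j) = spider_labeling B (leg_vertex i' j')"
    and bound: "j < B" "j' < B"
  shows "leg_vertex i j = leg_vertex i' j'"
proof -
  have dvd: "3 dvd leg_shift B i j" "3 dvd leg_shift B i' j'"
    by (auto simp: leg_shift_def)
  \<comment> \<open>Opposite parities would make the two shifts, both multiples of \<open>3\<close>, add up to \<open>2\<close>.\<close>
  have parity: "even j \<longleftrightarrow> even j'"
  proof (rule ccontr)
    assume "\<not> ?thesis"
    then have "leg_shift B i j + leg_shift B i' j' = 2"
      using eq by (auto simp: spider_labeling_leg_vertex split: if_splits)
    then show False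
      using dvd_add[OF dvd] by simp
  qed
  then have shift: "leg_shift B i j = leg_shift B i' j'"
    using eq by (auto simp: spider_labeling_leg_vertex split: if_splits)
  have "B > 0"
    using bound by simp
  \<comment> \<open>A nonpositive shift equals a nonnegative one only if both are \<open>0\<close>. This happens at
    distance \<open>0\<close> or \<open>1\<close> on leg \<open>1\<close> but only at distance \<open>0\<close> on another leg, so by parity both
    vertices are the center.\<close>
  have mixed: "a = 0 \<and> b = 0"
    if "leg_shift B 1 a = leg_shift B p b" "p \<noteq> 1" "even a \<longleftrightarrow> even b" for p a b
  proof -
    have "int (3 * (a div 2 * B ^ 2)) + int (3 * (Suc b div 2 * B ^ p)) = 0"
      using that(1,2) by (simp add: leg_shift_def algebra_simps)
    then have "a div 2 * B ^ 2 = 0" "Suc b div 2 * B ^ p = 0"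
      by linarith+
    then have "a div 2 = 0" "Suc b div 2 = 0"
      using \<open>B > 0\<close> by auto
    then show ?thesis
      using that(3) by presburger
  qed
  consider "i = 1" "i' = 1" | "i = 1" "i' \<noteq> 1" | "i \<noteq> 1" "i' = 1" | "i \<noteq> 1" "i' \<noteq> 1"
    by blast
  then show ?thesis
  proof cases
    case 1
    then have "j div 2 = j' div 2"
      using shift \<open>B > 0\<close> by (simp add: leg_shift_def flip: of_nat_mult of_nat_power)
    with parity have "j = j'"
      by presburger
    with 1 show ?thesis
      by simp
  next
    case 2
    then show ?thesis
      using mixed[of j i' j'] shift parity by (simp add: leg_vertex_def)
  next
    case 3
    then show ?thesis
      using mixed[of j' i j] shift parity by (simp add: leg_vertex_def)
  next
    case 4
    then have "int (3 * (Suc j div 2 * B ^ i)) = int (3 * (Suc j' div 2 * B ^ i'))"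
      using shift by (simp add: leg_shift_def)
    then have eq': "Suc j div 2 * B ^ i = Suc j' div 2 * B ^ i'"
      by linarith
    show ?thesis
    proof (cases "Suc j div 2 = 0 \<or> Suc j' div 2 = 0")
      case True
      then have "Suc j div 2 = 0" "Suc j' div 2 = 0"
        using eq' \<open>B > 0\<close> by auto
      then have "j = 0" "j' = 0"
        by presburger+
      then show ?thesis
        by (simp add: leg_vertex_def)
    next
      case False
      have "Suc j div 2 < B" "Suc j' div 2 < B"
        using bound by presburger+
      with False have "Suc j div 2 = Suc j' div 2 \<and> i = i'"
        using single_digit_numeral_unique[OF eq'] by simp
      moreover from this parity have "j = j'"
        by presburger
      ultimately show ?thesis
        by simp
    qed
  qed
qed

lemma vertex_labeling_spider:
  assumes "B > 0" and "\<And>i. i \<in> {1..d} \<Longrightarrow> l i < B"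
  shows "vertex_labeling (spider d l) (spider_labeling B)"
proof -
  have pos: "\<exists>i j. v = leg_vertex i j \<and> j < B" if "v \<in> pverts (spider d l)" for v
  proof (cases v)
    case Center
    with assms(1) show ?thesis
      by (auto simp: leg_vertex_def)
  next
    case (Leg i j)
    with that have "i \<in> {1..d}" "1 \<le> j" "j \<le> l i"
      by (auto simp: spider_def)
    with assms(2) Leg show ?thesis
      by (intro exI[of _ i] exI[of _ j]) (fastforce simp: leg_vertex_def)
  qed
  show ?thesis
    unfolding vertex_labeling_def
    by (rule inj_onI) (metis pos spider_labeling_eq_imp_eq)
qed

lemma num_edge_labels_spider_le:
  assumes "d \<ge> 2"
  shows "num_edge_labels (spider d l) (spider_labeling B) \<le> d"
proof -
  \<comment> \<open>The sums \<open>s\<^sub>1 = 0\<close> and \<open>s\<^sub>2, \<dots>, s\<^sub>d\<close>; leg \<open>1\<close> borrows \<open>s\<^sub>2\<close>, hence \<open>d \<ge> 2\<close>.\<close>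
  let ?S = "insert 0 ((\<lambda>i. int (3 * B ^ i)) ` {2..d})"
  have sum: "spider_labeling B (leg_vertex i j) + spider_labeling B (leg_vertex i (Suc j)) \<in> ?S"
    if "i \<in> {1..d}" for i j
    using that assms unfolding spider_labeling_consecutive_sum by auto
  have "edge_labeling (spider_labeling B) ` parcs (spider d l) \<subseteq> ?S"
  proof
    fix x
    assume "x \<in> edge_labeling (spider_labeling B) ` parcs (spider d l)"
    then obtain i j where "i \<in> {1..d}"
      "x = spider_labeling B (leg_vertex i j) + spider_labeling B (leg_vertex i (Suc j))"
      by (auto simp: spider_def spider_edges_def edge_labeling_def add.commute)
    with sum show "x \<in> ?S"
      by blast
  qed
  then have "num_edge_labels (spider d l) (spider_labeling B) \<le> card ?S"
    unfolding num_edge_labels_def by (intro card_mono) auto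
  also have "\<dots> \<le> Suc (card ((\<lambda>i. int (3 * B ^ i)) ` {2..d}))"
    by (rule card_insert_le_m1) auto
  also have "\<dots> \<le> Suc (card {2..d})"
    by (intro Suc_le_mono[THEN iffD2] card_image_le) auto
  also have "\<dots> = d"
    using assms by simp
  finally show ?thesis .
qed

lemma num_edge_labels_spider_ge:
  assumes "\<And>i. i \<in> {1..d} \<Longrightarrow> l i > 0" and "vertex_labeling (spider d l) f"
  shows "d \<le> num_edge_labels (spider d l) f"
proof -
  let ?N = "{v. (Center, v) \<in> parcs (spider d l)}"
  have "(\<lambda>i. Leg i 1) ` {1..d} \<subseteq> ?N"
    using assms(1) by (force simp: spider_def spider_edges_def leg_vertex_def)
  moreover have "finite ?N"
  proof -
    interpret pair_graph "spider d l"
      by (rule pair_graph_spider)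
    have "?N \<subseteq> pverts (spider d l)"
      using in_arcsD2 by auto
    then show ?thesis
      using finite_verts by (auto intro: finite_subset)
  qed
  ultimately have "card ((\<lambda>i. Leg i 1) ` {1..d}) \<le> card ?N"
    by (rule card_mono[rotated])
  moreover have "card ((\<lambda>i. Leg i 1) ` {1..d}) = d"
    by (subst card_image) (auto simp: inj_on_def)
  ultimately show ?thesis
    using card_neighbours_le_num_edge_labels[OF pair_graph_spider assms(2), of Center] by simp
qed

theorem theorem2p10:
  fixes \<Delta> :: nat and l :: "nat \<Rightarrow> nat"
  assumes "\<Delta> \<ge> 3"
    and "\<And>i. i \<in> {1..\<Delta>} \<Longrightarrow> l i > 0"
  shows "sum_index (spider \<Delta> l) = \<Delta>"
proof -
  define B where "B = Suc (\<Sum>i\<in>{1..\<Delta>}. l i)"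
  have "l i < B" if "i \<in> {1..\<Delta>}" for i
    using member_le_sum[of i "{1..\<Delta>}" l] that by (simp add: B_def)
  moreover have "B > 0"
    by (simp add: B_def)
  ultimately have labeling: "vertex_labeling (spider \<Delta> l) (spider_labeling B)"
    using vertex_labeling_spider by blast
  have "num_edge_labels (spider \<Delta> l) (spider_labeling B) = \<Delta>"
    using num_edge_labels_spider_le[of \<Delta> l B] num_edge_labels_spider_ge[OF assms(2) labeling] assms(1)
    by simp
  with labeling show ?thesis
    unfolding sum_index_def using assms(1) num_edge_labels_spider_ge[OF assms(2)]
    by (intro Least_equality) auto
qed

end
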